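(* There exists a family of binary strings $(w_k)_{k \ge 1}$ over the alphabet $\{a,b\}$ such that the ratio $z_e(w_k)/z_{end}(w_k)$ asymptotically approaches $2$ as $k \to \infty$.
   Context: For a string $w$, a parsing of $w$ is a sequence of non-empty strings $q_1,\ldots,q_z$ with $w = q_1\cdots q_z$ (the phrases). The (greedy) LZ-End parsing of $w$ is the parsing $q_1,\ldots,q_{z_e}$ determined from left to right by: $q_i$ is a single symbol if that position is the leftmost occurrence of the symbol in $w$; otherwise $q_i$ is the longest prefix of $q_i \cdots q_{z_e}$ (the remaining suffix of $w$) that occurs as a suffix of $q_1 \cdots q_j$ for some $j < i$. Its number of phrases is denoted $z_e(w)$. An LZ-End-like parsing of $w$ is a parsing $q_1,\ldots,q_z$ such that each $q_i$ is either a single symbol at its leftmost occurrence in $w$, or a (not necessarily longest) suffix of $q_1\cdots q_j$ for some $j<i$. The minimum number of phrases over all LZ-End-like parsings of $w$ is denoted $z_{end}(w)$ (the size of an optimal LZ-End parsing). *)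

theory Defs
  imports Complex_Main "HOL-Library.Sublist"
begin

text \<open>
  Phrases are indexed from 0: the phrase \<open>q\<^sub>m\<close> is \<open>qs ! (m - 1)\<close>, and \<open>concat (take j qs)\<close> consists of
  the phrases \<open>q\<^sub>1, \<dots>, q\<^sub>j\<close>. For \<open>i = m - 1\<close> the condition \<open>j < m\<close> becomes \<open>j \<le> i\<close>.
\<close>

definition parsing :: "'a list \<Rightarrow> 'a list list \<Rightarrow> bool" where
  "parsing w qs \<longleftrightarrow> concat qs = w \<and> [] \<notin> set qs"

text \<open>\<open>p\<close> may be copied when phrase number \<open>i\<close> is formed (the value \<open>j = 0\<close> only admits \<open>p = []\<close>).\<close>

definition end_source :: "'a list list \<Rightarrow> nat \<Rightarrow> 'a list \<Rightarrow> bool" where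
  "end_source qs i p \<longleftrightarrow> (\<exists>j\<le>i. suffix p (concat (take j qs)))"

definition lz_end_like :: "'a list \<Rightarrow> 'a list list \<Rightarrow> bool" where
  "lz_end_like w qs \<longleftrightarrow> parsing w qs \<and>
     (\<forall>i<length qs.
        (\<exists>c. qs ! i = [c] \<and> c \<notin> set (concat (take i qs))) \<or> end_source qs i (qs ! i))"

text \<open>The suffix of the word that remains when phrase number \<open>i\<close> is formed is \<open>concat (drop i qs)\<close>.\<close>

definition lz_end_greedy :: "'a list \<Rightarrow> 'a list list \<Rightarrow> bool" where
  "lz_end_greedy w qs \<longleftrightarrow> parsing w qs \<and>
     (\<forall>i<length qs. let r = concat (drop i qs) in
        if hd r \<notin> set (concat (take i qs)) then qs ! i = [hd r]
        else is_arg_max length (\<lambda>p. prefix p r \<and> end_source qs i p) (qs ! i))"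

definition z_e :: "'a list \<Rightarrow> nat" where
  "z_e w = length (THE qs. lz_end_greedy w qs)"

definition z_end :: "'a list \<Rightarrow> nat" where
  "z_end w = (LEAST n. \<exists>qs. lz_end_like w qs \<and> length qs = n)"


subsection \<open>Well-definedness\<close>

lemma lz_end_greedy_imp_like:
  assumes "lz_end_greedy w qs"
  shows "lz_end_like w qs"
  using assms unfolding lz_end_greedy_def lz_end_like_def Let_def
proof (safe, goal_cases)
  case (1 i)
  show ?case
  proof (cases "hd (concat (drop i qs)) \<notin> set (concat (take i qs))")
    case True
    with 1 show ?thesis by (metis (no_types, lifting))
  next
    case False
    with 1 have "is_arg_max length
        (\<lambda>p. prefix p (concat (drop i qs)) \<and> end_source qs i p) (qs ! i)" by auto
    with 1 show ?thesis by (simp add: is_arg_max_def)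
  qed
qed

lemma end_source_cong:
  assumes "take i qs = take i rs"
  shows "end_source qs i p \<longleftrightarrow> end_source rs i p"
proof -
  have "take j qs = take j rs" if "j \<le> i" for j
    using assms that by (metis min.absorb1 take_take)
  then show ?thesis by (auto simp: end_source_def)
qed

lemma lz_end_greedy_take_eq:
  assumes q: "lz_end_greedy w qs" and r: "lz_end_greedy w rs" and "i \<le> length qs"
  shows "take i qs = take i rs"
  using assms(3)
proof (induction i)
  case 0
  then show ?case by simp
next
  case (Suc i)
  then have eq: "take i qs = take i rs" and i: "i < length qs" by auto
  have w: "concat (take i qs) @ concat (drop i qs) = w"
    "concat (take i rs) @ concat (drop i rs) = w"
    using q r by (simp_all add: lz_end_greedy_def parsing_def flip: concat_append)
  with eq have rest: "concat (drop i qs) = concat (drop i rs)"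
    by (metis append_same_eq same_append_eq)
  have "qs ! i \<noteq> []"
    using q i unfolding lz_end_greedy_def parsing_def by (metis nth_mem)
  then have "concat (drop i qs) \<noteq> []"
    using i by (simp flip: Cons_nth_drop_Suc)
  then have j: "i < length rs"
    using rest by (metis concat.simps(1) drop_all not_le)
  have "qs ! i = rs ! i"
  proof (cases "hd (concat (drop i qs)) \<notin> set (concat (take i qs))")
    case True
    then have "qs ! i = [hd (concat (drop i qs))]" "rs ! i = [hd (concat (drop i rs))]"
      using q r i j eq rest unfolding lz_end_greedy_def Let_def by auto
    with rest show ?thesis by simp
  next
    case False
    let ?P = "\<lambda>p. prefix p (concat (drop i qs)) \<and> end_source qs i p"
    have "is_arg_max length ?P (qs ! i)"
      using q i False unfolding lz_end_greedy_def Let_def by auto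
    moreover have "is_arg_max length ?P (rs ! i)"
      using r j False eq rest unfolding lz_end_greedy_def Let_def
      by (auto simp: end_source_cong[OF eq])
    ultimately have "prefix (qs ! i) (concat (drop i qs))"
      "prefix (rs ! i) (concat (drop i qs))" "length (qs ! i) = length (rs ! i)"
      by (auto simp: is_arg_max_def not_less intro: le_antisym)
    then show ?thesis by (auto simp: prefix_def)
  qed
  with eq i j show ?case by (simp add: take_Suc_conv_app_nth)
qed

lemma lz_end_greedy_unique:
  assumes "lz_end_greedy w qs" "lz_end_greedy w rs"
  shows "qs = rs"
  using lz_end_greedy_take_eq[OF assms order.refl]
    lz_end_greedy_take_eq[OF assms(2,1) order.refl]
  by (metis nat_le_linear take_all)

lemma lz_end_greedy_extend:
  assumes "[] \<notin> set qs"
    and "\<forall>i<length qs. let r = concat (drop i qs) @ v in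
        if hd r \<notin> set (concat (take i qs)) then qs ! i = [hd r]
        else is_arg_max length (\<lambda>p. prefix p r \<and> end_source qs i p) (qs ! i)"
    and "\<forall>c\<in>set (concat qs). end_source qs (length qs) [c]"
  shows "\<exists>rs. lz_end_greedy (concat qs @ v) rs"
  using assms
proof (induction "length v" arbitrary: qs v rule: less_induct)
  case less
  show ?case
  proof (cases "v = []")
    case True
    then have "lz_end_greedy (concat qs @ v) qs"
      using less.prems by (simp add: lz_end_greedy_def parsing_def)
    then show ?thesis ..
  next
    case False
    let ?n = "length qs"
    let ?P = "\<lambda>p. prefix p v \<and> end_source qs ?n p"
    have "\<exists>q. q \<noteq> [] \<and> prefix q v \<and>
      (if hd v \<notin> set (concat qs) then q = [hd v] else is_arg_max length ?P q)"
    proof (cases "hd v \<in> set (concat qs)")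
      case True
      have hd_v: "prefix [hd v] v" using False by (cases v) simp_all
      then have P: "?P [hd v]" using True less.prems(3) by blast
      have "\<forall>y. ?P y \<longrightarrow> length y < Suc (length v)"
        by (simp add: prefix_length_le less_Suc_eq_le)
      with P have "\<exists>p. ?P p \<and> (\<forall>y. ?P y \<longrightarrow> length y \<le> length p)"
        by (rule ex_has_greatest_nat[where P = ?P and k = "[hd v]" and b = "Suc (length v)"])
      then obtain p where p: "?P p" "\<And>y. ?P y \<Longrightarrow> length y \<le> length p" by blast
      have "is_arg_max length ?P p"
        unfolding is_arg_max_def using p by (meson not_less)
      moreover have "p \<noteq> []" using p(2)[OF P] by auto
      ultimately show ?thesis using p(1) True by auto
    next
      case new: False
      have "prefix [hd v] v" using False by (cases v) simp_all
      with new show ?thesis by (intro exI[of _ "[hd v]"]) simp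
    qed
    then obtain q where q: "q \<noteq> []" "prefix q v"
      "if hd v \<notin> set (concat qs) then q = [hd v] else is_arg_max length ?P q" by blast
    then obtain u where v: "v = q @ u" by (auto simp: prefix_def)
    have src: "end_source (qs @ [q]) i p \<longleftrightarrow> end_source qs i p" if "i \<le> ?n" for i p
      by (rule end_source_cong) (use that in simp)
    have "\<exists>rs. lz_end_greedy (concat (qs @ [q]) @ u) rs"
    proof (rule less.hyps)
      show "length u < length v" using v q(1) by simp
      show "[] \<notin> set (qs @ [q])" using q(1) less.prems(1) by auto
      show "\<forall>i<length (qs @ [q]). let r = concat (drop i (qs @ [q])) @ u in
        if hd r \<notin> set (concat (take i (qs @ [q]))) then (qs @ [q]) ! i = [hd r]
        else is_arg_max length (\<lambda>p. prefix p r \<and> end_source (qs @ [q]) i p) ((qs @ [q]) ! i)"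
      proof (intro allI impI)
        fix i assume "i < length (qs @ [q])"
        then consider "i < ?n" | "i = ?n" by fastforce
        then show "let r = concat (drop i (qs @ [q])) @ u in
          if hd r \<notin> set (concat (take i (qs @ [q]))) then (qs @ [q]) ! i = [hd r]
          else is_arg_max length (\<lambda>p. prefix p r \<and> end_source (qs @ [q]) i p) ((qs @ [q]) ! i)"
        proof cases
          case 1
          then have "concat (drop i (qs @ [q])) @ u = concat (drop i qs) @ v"
            "take i (qs @ [q]) = take i qs" "(qs @ [q]) ! i = qs ! i"
            "end_source (qs @ [q]) i = end_source qs i"
            using v src[of i] by (simp_all add: nth_append fun_eq_iff)
          with less.prems(2) 1 show ?thesis by presburger
        next
          case 2
          then have "concat (drop i (qs @ [q])) @ u = v"
            "take i (qs @ [q]) = qs" "(qs @ [q]) ! i = q"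
            "end_source (qs @ [q]) i = end_source qs ?n"
            using v src[of i] by (simp_all add: fun_eq_iff)
          with q(3) show ?thesis unfolding Let_def by presburger
        qed
      qed
      show "\<forall>c\<in>set (concat (qs @ [q])). end_source (qs @ [q]) (length (qs @ [q])) [c]"
      proof
        fix c assume c: "c \<in> set (concat (qs @ [q]))"
        show "end_source (qs @ [q]) (length (qs @ [q])) [c]"
        proof (cases "c \<in> set (concat qs)")
          case True
          then have "end_source (qs @ [q]) ?n [c]"
            using less.prems(3) src by blast
          then show ?thesis unfolding end_source_def by (metis le_SucI length_append_singleton)
        next
          case new: False
          have "hd v \<notin> set (concat qs)"
          proof
            assume "hd v \<in> set (concat qs)"
            then have "end_source qs ?n q" using q(3) by (simp add: is_arg_max_def)
            then obtain j where "suffix q (concat (take j qs))"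
              unfolding end_source_def by blast
            then have "set q \<subseteq> set (concat (take j qs))" by (rule set_mono_suffix)
            also have "\<dots> \<subseteq> set (concat qs)" by (auto dest: in_set_takeD)
            finally have "set q \<subseteq> set (concat qs)" .
            with new c show False by auto
          qed
          with q(3) have "q = [hd v]" by simp
          with new c have "q = [c]" by simp
          then have "suffix [c] (concat (take (Suc ?n) (qs @ [q])))" by (simp add: suffix_def)
          then show ?thesis unfolding end_source_def by (metis length_append_singleton order.refl)
        qed
      qed
    qed
    with v show ?thesis by simp
  qed
qed

lemma ex1_lz_end_greedy: "\<exists>!qs. lz_end_greedy w qs"
  using lz_end_greedy_extend[of "[]" w] lz_end_greedy_unique[of w] by auto

lemma z_e_eqI: "lz_end_greedy w qs \<Longrightarrow> z_e w = length qs"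
  unfolding z_e_def using ex1_lz_end_greedy[of w] by (metis the1_equality)

lemma z_end_attained: "\<exists>qs. lz_end_like w qs \<and> length qs = z_end w"
  unfolding z_end_def
  by (rule LeastI_ex) (use ex1_lz_end_greedy lz_end_greedy_imp_like in blast)

end

theory Submission
  imports Defs "HOL-Real_Asymp.Real_Asymp"
begin

text \<open>
  For \<open>K = 2\<^sup>k\<close> take \<open>w\<^sub>k = a\<^sup>K bbbb \<cdot> abbb \<cdot> aabbb \<cdots> a\<^sup>K bbb\<close>. The run \<open>a\<^sup>K\<close> costs \<open>k + 1\<close>
  phrases. Greedy then splits \<open>bbbb\<close> as \<open>b|b|bb\<close>, so \<open>a\<^sup>i bb\<close> may be copied but \<open>a\<^sup>i bbb\<close> may not, and
  since the exponents increase this does not improve later: every block costs the two phrases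
  \<open>a\<^sup>i bb|b\<close>. Splitting \<open>bbbb\<close> as \<open>b|b|b|b\<close> instead makes each block \<open>a\<^sup>i bbb\<close> a single phrase. No
  parsing does better than one phrase per block, because \<open>b a\<^sup>i b\<close> first occurs in block \<open>i\<close>.
\<close>

section \<open>Incremental parsing\<close>

text \<open>Here \<open>qs\<close> consists of all phrases read so far, so the index of
  \<open>end_source\<close> disappears and parsings can be grown one phrase at a time.\<close>

definition copyable :: "'a list list \<Rightarrow> 'a list \<Rightarrow> bool" where
  "copyable qs p \<longleftrightarrow> end_source qs (length qs) p"

lemma copyable_Nil [simp]: "copyable [] p \<longleftrightarrow> p = []"
  by (simp add: copyable_def end_source_def)

lemma copyable_snoc:
  "copyable (qs @ [q]) p \<longleftrightarrow> copyable qs p \<or> suffix p (concat qs @ q)"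
  by (auto simp: copyable_def end_source_def le_Suc_eq)

lemma copyable_append: "copyable qs p \<Longrightarrow> copyable (qs @ rs) p"
  by (induction rs rule: rev_induct) (simp_all add: copyable_snoc flip: append_assoc)

lemma copyable_imp_sublist: "copyable qs p \<Longrightarrow> sublist p (concat qs)"
  by (induction qs rule: rev_induct) (auto simp: copyable_snoc sublist_appendI intro: sublist_order.order.trans)

lemma end_source_iff_copyable:
  assumes "i \<le> length qs"
  shows "end_source qs i p \<longleftrightarrow> copyable (take i qs) p"
  using assms end_source_cong[of i qs "take i qs"] by (simp add: copyable_def)

lemma copyable_suffix: "copyable qs p \<Longrightarrow> suffix q p \<Longrightarrow> copyable qs q"
  unfolding copyable_def end_source_def by (blast intro: suffix_order.trans)

definition greedy_phrase :: "'a list list \<Rightarrow> 'a list \<Rightarrow> 'a list \<Rightarrow> bool" where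
  "greedy_phrase qs r q \<longleftrightarrow>
     (if hd r \<notin> set (concat qs) then q = [hd r]
      else is_arg_max length (\<lambda>p. prefix p r \<and> copyable qs p) q)"

text \<open>Whether a finished phrase was greedy depends on the text after it, so the unread
  remainder \<open>v\<close> is a parameter; appending a phrase takes it off the front of the
  remainder.\<close>

definition greedy_prefix :: "'a list list \<Rightarrow> 'a list \<Rightarrow> bool" where
  "greedy_prefix qs v \<longleftrightarrow> [] \<notin> set qs \<and>
     (\<forall>i<length qs. greedy_phrase (take i qs) (concat (drop i qs) @ v) (qs ! i))"

lemma greedy_prefix_Nil [simp]: "greedy_prefix [] v"
  by (simp add: greedy_prefix_def)

lemma greedy_prefix_snoc:
  "greedy_prefix (qs @ [q]) v \<longleftrightarrow> greedy_prefix qs (q @ v) \<and> q \<noteq> [] \<and> greedy_phrase qs (q @ v) q"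
  by (auto simp: greedy_prefix_def less_Suc_eq all_conj_distrib nth_append)

lemma greedy_prefix_imp_lz_end_greedy:
  assumes "greedy_prefix qs []"
  shows "lz_end_greedy (concat qs) qs"
  using assms
  by (auto simp: greedy_prefix_def greedy_phrase_def lz_end_greedy_def parsing_def Let_def
      end_source_iff_copyable)

text \<open>A competing prefix of \<open>q @ v\<close> is either a prefix of \<open>q\<close> or
  some \<open>q @ t\<close>, so maximality only requires excluding copyable proper extensions of
  \<open>q\<close>.\<close>

lemma greedy_phraseI:
  assumes "hd (q @ v) \<in> set (concat qs)" "copyable qs q"
    and "\<And>t. prefix t v \<Longrightarrow> copyable qs (q @ t) \<Longrightarrow> t = []"
  shows "greedy_phrase qs (q @ v) q"
proof -
  have "length p \<le> length q" if "prefix p (q @ v)" "copyable qs p" for p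
    using that assms(3) by (auto simp: prefix_append dest: prefix_length_le)
  with assms(1,2) show ?thesis
    by (auto simp: greedy_phrase_def is_arg_max_def not_less)
qed

lemma lz_end_like_Nil: "lz_end_like [] []"
  by (simp add: lz_end_like_def parsing_def)

lemma lz_end_like_snoc:
  assumes "lz_end_like w qs" "q \<noteq> []" "copyable qs q \<or> (\<exists>c. q = [c] \<and> c \<notin> set w)"
  shows "lz_end_like (w @ q) (qs @ [q])"
  using assms
  by (auto simp: lz_end_like_def parsing_def nth_append less_Suc_eq end_source_iff_copyable)

section \<open>The word family\<close>

lemma suffix_replicate_iff: "suffix p (replicate n x) \<longleftrightarrow> (\<exists>m\<le>n. p = replicate m x)"
proof
  assume "suffix p (replicate n x)"
  then have "length p \<le> n" "set p \<subseteq> {x}"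
    using suffix_length_le[of p "replicate n x"] set_mono_suffix[of p "replicate n x"] by auto
  moreover from this have "p = replicate (length p) x"
    by (intro replicate_eqI) auto
  ultimately show "\<exists>m\<le>n. p = replicate m x" by blast
next
  assume "\<exists>m\<le>n. p = replicate m x"
  then show "suffix p (replicate n x)"
    by (metis suffix_def le_add_diff_inverse2 replicate_add)
qed

fun doubling :: "'a \<Rightarrow> nat \<Rightarrow> 'a list list" where
  "doubling a 0 = [[a]]"
| "doubling a (Suc k) = doubling a k @ [replicate (2 ^ k) a]"

lemma concat_doubling [simp]: "concat (doubling a k) = replicate (2 ^ k) a"
  by (induction k) (simp_all add: mult_2 replicate_add)

lemma length_doubling [simp]: "length (doubling a k) = Suc k"
  by (induction k) simp_all

lemma copyable_doubling: "copyable (doubling a k) p \<longleftrightarrow> (\<exists>m\<le>2 ^ k. p = replicate m a)"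
proof (induction k)
  case 0
  then show ?case
    using copyable_snoc[of "[]" "[a]" p] suffix_replicate_iff[of p 1 a] by auto
next
  case (Suc k)
  have "suffix p (replicate (2 ^ k) a @ replicate (2 ^ k) a) \<longleftrightarrow> (\<exists>m\<le>2 ^ Suc k. p = replicate m a)"
    by (simp add: suffix_replicate_iff mult_2 flip: replicate_add)
  with Suc show ?case by (auto simp: copyable_snoc)
qed

lemma lz_end_like_doubling: "lz_end_like (replicate (2 ^ k) a) (doubling a k)"
proof (induction k)
  case 0
  then show ?case using lz_end_like_snoc[OF lz_end_like_Nil, of "[a]"] by simp
next
  case (Suc k)
  then have "lz_end_like (replicate (2 ^ k) a @ replicate (2 ^ k) a) (doubling a (Suc k))"
    unfolding doubling.simps by (rule lz_end_like_snoc) (auto simp: copyable_doubling)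
  then show ?case by (simp add: mult_2 replicate_add)
qed

text \<open>Each phrase after the first copies the whole text before it. Nothing longer is copyable,
  because a source lies within that text; hence the remainder \<open>v\<close> is arbitrary.\<close>

lemma greedy_prefix_doubling: "greedy_prefix (doubling a k) v"
proof (induction k arbitrary: v)
  case 0
  then show ?case
    using greedy_prefix_snoc[of "[]" "[a]" v] by (simp add: greedy_phrase_def)
next
  case (Suc k)
  have "greedy_phrase (doubling a k) (replicate (2 ^ k) a @ v) (replicate (2 ^ k) a)"
  proof (rule greedy_phraseI)
    fix t assume "copyable (doubling a k) (replicate (2 ^ k) a @ t)"
    then show "t = []"
      by (auto dest!: copyable_imp_sublist sublist_length_le)
  qed (auto simp: copyable_doubling hd_append)
  with Suc show ?case by (simp add: greedy_prefix_snoc)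
qed

text \<open>The number \<open>n\<close> of later blocks is independent of \<open>k\<close> to allow
  induction on it; the family itself takes \<open>n = 2 ^ k\<close>.\<close>

fun blocks :: "'a \<Rightarrow> 'a \<Rightarrow> nat \<Rightarrow> nat \<Rightarrow> 'a list" where
  "blocks a b k 0 = replicate (2 ^ k) a @ [b, b, b, b]"
| "blocks a b k (Suc n) = blocks a b k n @ replicate (Suc n) a @ [b, b, b]"

fun greedy_blocks :: "'a \<Rightarrow> 'a \<Rightarrow> nat \<Rightarrow> nat \<Rightarrow> 'a list list" where
  "greedy_blocks a b k 0 = doubling a k @ [[b], [b], [b, b]]"
| "greedy_blocks a b k (Suc n) = greedy_blocks a b k n @ [replicate (Suc n) a @ [b, b], [b]]"

fun short_blocks :: "'a \<Rightarrow> 'a \<Rightarrow> nat \<Rightarrow> nat \<Rightarrow> 'a list list" where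
  "short_blocks a b k 0 = doubling a k @ [[b], [b], [b], [b]]"
| "short_blocks a b k (Suc n) = short_blocks a b k n @ [replicate (Suc n) a @ [b, b, b]]"

lemma concat_greedy_blocks [simp]: "concat (greedy_blocks a b k n) = blocks a b k n"
  by (induction n) simp_all

lemma length_greedy_blocks: "length (greedy_blocks a b k n) = k + 4 + 2 * n"
  by (induction n) simp_all

lemma concat_short_blocks [simp]: "concat (short_blocks a b k n) = blocks a b k n"
  by (induction n) simp_all

lemma length_short_blocks: "length (short_blocks a b k n) = k + 5 + n"
  by (induction n) simp_all

lemma set_blocks: "set (blocks a b k n) = {a, b}"
  by (induction n) (simp_all add: set_replicate_conv_if insert_commute)

lemma blocks_ends: "\<exists>xs. blocks a b k n = xs @ [b]"
  by (cases n) auto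

lemma prefix_blocks: "m \<le> n \<Longrightarrow> prefix (blocks a b k m) (blocks a b k n)"
  by (induction n) (auto simp: le_Suc_eq intro: prefix_order.trans)

section \<open>At least one phrase per block\<close>

context
  fixes a b :: 'a
  assumes ab: "a \<noteq> b"
begin

section \<open>First occurrences of the pattern \<open>b a^i b\<close>\<close>

lemma sublist_snoc_iff: "sublist p (xs @ [x]) \<longleftrightarrow> sublist p xs \<or> suffix p (xs @ [x])"
  by (auto simp: sublist_altdef prefix_snoc intro: prefix_order.trans)

text \<open>Read from the right, both strings show a run of \<open>a\<close> enclosed by two
  \<open>b\<close>, so the run lengths must agree.\<close>

lemma suffix_bab:
  assumes "suffix (b # replicate i a @ [b]) (xs @ b # replicate l a @ [b])"
  shows "l = i"
proof -
  have "prefix (replicate i a @ [b]) (replicate l a @ b # rev xs)"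
    using assms by (simp add: suffix_to_prefix)
  then show ?thesis
  proof (induction i arbitrary: l)
    case 0
    then show ?case using ab by (cases l) auto
  next
    case (Suc i)
    then show ?case using ab by (cases l) auto
  qed
qed

text \<open>Every added letter is an \<open>a\<close>, while the pattern ends in \<open>b\<close>;
  so no occurrence can end at an added letter.\<close>

lemma not_sublist_run:
  assumes "l \<noteq> i" "\<not> sublist (b # replicate i a @ [b]) (xs @ [b])"
  shows "\<not> sublist (b # replicate i a @ [b]) (xs @ b # replicate l a)"
  using assms(2)
proof (induction l)
  case (Suc l)
  have "\<not> suffix (b # replicate i a @ [b]) ((xs @ b # replicate l a) @ [a])"
    using ab by (simp add: suffix_to_prefix)
  with Suc show ?case
    using sublist_snoc_iff[of _ "xs @ b # replicate l a" a]
    by (simp add: replicate_append_same)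
qed simp

lemma not_sublist_run_end:
  assumes "l \<noteq> i" "\<not> sublist (b # replicate i a @ [b]) (xs @ [b])"
  shows "\<not> sublist (b # replicate i a @ [b]) (xs @ b # replicate l a @ [b])"
  using not_sublist_run[OF assms] suffix_bab[of i xs l] assms(1)
    sublist_snoc_iff[of _ "xs @ b # replicate l a" b] by auto

text \<open>The pattern has two \<open>b\<close>, the text only one. Thus the opening run, which no
  \<open>b\<close> precedes, may have the same exponent \<open>2 ^ k\<close> as the last block
  without making the pattern of that block old.\<close>

lemma not_sublist_start: "\<not> sublist (b # replicate i a @ [b]) (replicate m a @ [b])"
proof -
  have "\<not> sublist (b # replicate i a @ [b]) (replicate m a)"
    using ab by (auto dest!: set_mono_sublist)
  moreover have "\<not> suffix (b # replicate i a) (replicate m a)"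
    using ab by (auto dest!: set_mono_suffix)
  ultimately show ?thesis
    by (auto simp: sublist_snoc_iff simp flip: append_Cons)
qed

lemma not_sublist_blocks:
  assumes "n < i"
  shows "\<not> sublist (b # replicate i a @ [b]) (blocks a b k n)"
proof -
  \<comment> \<open>Two adjacent \<open>b\<close> enclose an empty run, so this is the case
    \<open>l = 0\<close>; \<open>n < i\<close> makes \<open>i\<close> nonzero.\<close>
  have step: "\<not> sublist (b # replicate i a @ [b]) (xs @ [b, b])"
    if "\<not> sublist (b # replicate i a @ [b]) (xs @ [b])" for xs
    using not_sublist_run_end[of 0 i xs] assms that by simp
  show ?thesis
    using assms
  proof (induction n)
    case 0
    show ?case
      using step[of "replicate (2 ^ k) a"] step[of "replicate (2 ^ k) a @ [b]"]
        step[of "replicate (2 ^ k) a @ [b, b]"] not_sublist_start by simp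
  next
    case (Suc n)
    obtain xs where xs: "blocks a b k n = xs @ [b]" using blocks_ends[of a b k n] by blast
    have "\<not> sublist (b # replicate i a @ [b]) (xs @ b # replicate (Suc n) a @ [b])"
      by (rule not_sublist_run_end) (use Suc xs in auto)
    with xs show ?case
      using step[of "xs @ b # replicate (Suc n) a"]
        step[of "xs @ b # replicate (Suc n) a @ [b]"] by simp
  qed
qed

text \<open>Let \<open>f i\<close> be the least number of phrases covering
  \<open>blocks a b k i\<close>. If the phrase that completes this prefix also completed the next
  block, it would contain \<open>b a^(i+1) b\<close>, starting at the last \<open>b\<close> of the
  prefix, and would have to copy it from earlier text, where it does not occur. So \<open>f\<close>
  is strictly increasing, with \<open>f 0 > 0\<close>.\<close>

lemma length_lz_end_like_ge:
  assumes "lz_end_like (blocks a b k n) qs"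
  shows "n < length qs"
proof -
  define w where "w = blocks a b k n"
  define reach where "reach m = length (concat (take m qs))" for m
  define f where "f i = (LEAST m. length (blocks a b k i) \<le> reach m)" for i
  have w: "concat qs = w" using assms by (simp add: lz_end_like_def parsing_def w_def)
  have le: "length (blocks a b k i) \<le> length w" if "i \<le> n" for i
    unfolding w_def using prefix_blocks[OF that] by (rule prefix_length_le)
  have ex: "length (blocks a b k i) \<le> reach (length qs)" if "i \<le> n" for i
    using le[OF that] by (simp add: reach_def w)
  have f: "length (blocks a b k i) \<le> reach (f i)" "f i \<le> length qs" if "i \<le> n" for i
    unfolding f_def using ex[OF that] by (auto intro: LeastI Least_le)
  have f_pos: "0 < f i" if "i \<le> n" for i
    using f(1)[OF that] by (cases "f i"; cases i) (auto simp: reach_def)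
  have f_step: "f i < f (Suc i)" if "Suc i \<le> n" for i
  proof (rule ccontr)
    assume "\<not> f i < f (Suc i)"
    define m where "m = f i - 1"
    have i: "i \<le> n" using that by simp
    have m: "f i = Suc m" using f_pos[OF i] by (simp add: m_def)
    \<comment> \<open>By minimality of \<open>f i\<close>, the phrase \<open>qs ! m\<close> starts
      no later than the final \<open>b\<close> of \<open>blocks a b k i\<close>.\<close>
    have lt: "reach m < length (blocks a b k i)"
      using not_less_Least[of m "\<lambda>m. length (blocks a b k i) \<le> reach m"] m
      by (simp add: f_def)
    have mq: "m < length qs" using f(2)[OF i] m by simp
    have "reach (f (Suc i)) \<le> reach (Suc m)"
      using \<open>\<not> f i < f (Suc i)\<close> m
      by (metis reach_def not_less take_add le_Suc_ex concat_append length_append le_add1)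
    with f(1)[OF that] have ge: "length (blocks a b k (Suc i)) \<le> reach (Suc m)" by simp
    let ?pre = "concat (take m qs)"
    have "prefix (concat (take (Suc m) qs)) w"
      by (metis w append_take_drop_id concat_append prefixI)
    moreover have "prefix (blocks a b k (Suc i)) w"
      using prefix_blocks[OF that] by (simp add: w_def)
    ultimately have pre: "prefix (blocks a b k (Suc i)) (?pre @ qs ! m)"
      using ge mq prefix_length_prefix
      by (fastforce simp: reach_def take_Suc_conv_app_nth)
    obtain xs where xs: "blocks a b k i = xs @ [b]" using blocks_ends[of a b k i] by blast
    have "prefix ?pre (blocks a b k (Suc i))"
      by (rule prefix_length_prefix[of _ "?pre @ qs ! m"])
        (use pre lt in \<open>auto simp: reach_def\<close>)
    then have "prefix ?pre xs"
      by (rule prefix_length_prefix) (use lt xs in \<open>auto simp: reach_def\<close>)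
    then obtain ys where ys: "xs = ?pre @ ys" by (auto simp: prefix_def)
    obtain zs where "?pre @ qs ! m = blocks a b k (Suc i) @ zs"
      using pre by (auto simp: prefix_def)
    then have q: "qs ! m = ys @ (b # replicate (Suc i) a @ [b]) @ [b, b] @ zs"
      using xs ys by simp
    then have sub: "sublist (b # replicate (Suc i) a @ [b]) (qs ! m)"
      by (metis sublist_appendI)
    \<comment> \<open>The phrase has more than one letter, which rules out a new single
      symbol.\<close>
    have "end_source qs m (qs ! m)"
      using assms mq q unfolding lz_end_like_def by (auto simp: Cons_eq_append_conv append_eq_Cons_conv)
    then have "sublist (qs ! m) ?pre"
      using mq by (auto simp: end_source_iff_copyable dest: copyable_imp_sublist)
    with sub have "sublist (b # replicate (Suc i) a @ [b]) (blocks a b k i)"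
      using xs ys by (metis append_assoc sublist_append_rightI sublist_order.order.trans)
    then show False using not_sublist_blocks[of i "Suc i"] by simp
  qed
  have "i < f i" if "i \<le> n" for i
    using that
  proof (induction i)
    case 0
    then show ?case using f_pos by simp
  next
    case (Suc i)
    then show ?case using f_step[of i] by simp
  qed
  with f(2)[of n] show ?thesis by (meson less_le_trans order.refl)
qed

section \<open>One phrase per block suffices\<close>

text \<open>The second claim drives the first: every \<open>a^i bbb\<close> with \<open>i\<close> at
  most \<open>2 ^ k\<close> is a suffix of \<open>a^(2^k) bbb\<close>, which stays copyable
  forever.\<close>

lemma lz_end_like_short_blocks:
  assumes "n \<le> 2 ^ k"
  shows "lz_end_like (blocks a b k n) (short_blocks a b k n)"
    and "copyable (short_blocks a b k n) (replicate (2 ^ k) a @ [b, b, b])"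
  using assms
proof (induction n)
  case 0
  let ?A = "replicate (2 ^ k) a"
  have b: "copyable ((doubling a k @ [[b]]) @ rs) [b]" for rs
    by (rule copyable_append) (simp add: copyable_snoc)
  { case 1
    have 1: "lz_end_like (?A @ [b]) (doubling a k @ [[b]])"
      by (rule lz_end_like_snoc[OF lz_end_like_doubling]) (use ab in auto)
    have 2: "lz_end_like (?A @ [b, b]) (doubling a k @ [[b], [b]])"
      using lz_end_like_snoc[OF 1, of "[b]"] b[of "[]"] by simp
    have 3: "lz_end_like (?A @ [b, b, b]) (doubling a k @ [[b], [b], [b]])"
      using lz_end_like_snoc[OF 2, of "[b]"] b[of "[[b]]"] by simp
    show ?case
      using lz_end_like_snoc[OF 3, of "[b]"] b[of "[[b], [b]]"] by simp
  next
    case 2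
    \<comment> \<open>The third single \<open>b\<close> puts a phrase end right after
      \<open>a^(2^k) bbb\<close>.\<close>
    have "copyable ((doubling a k @ [[b], [b]]) @ [[b]]) (?A @ [b, b, b])"
      unfolding copyable_snoc by simp
    from copyable_append[OF this, of "[[b]]"] show ?case by simp
  }
next
  case (Suc n)
  { case 1
    have "suffix (replicate (Suc n) a) (replicate (2 ^ k) a)"
      unfolding suffix_replicate_iff using 1 by blast
    then have "suffix (replicate (Suc n) a @ [b, b, b]) (replicate (2 ^ k) a @ [b, b, b])"
      by (simp only: same_suffix_suffix)
    with Suc 1 have "copyable (short_blocks a b k n) (replicate (Suc n) a @ [b, b, b])"
      using copyable_suffix by simp
    with Suc 1 show ?case
      using lz_end_like_snoc[of "blocks a b k n" _ "replicate (Suc n) a @ [b, b, b]"] by simp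
  next
    case 2
    then show ?case using Suc by (simp add: copyable_append)
  }
qed

section \<open>Greedy needs two phrases per block\<close>

text \<open>Beyond the run, phrases end after one, two and four letters \<open>b\<close>. The
  missing end after three is what costs greedy a second phrase per block.\<close>

lemma copyable_greedy_blocks_0:
  "copyable (greedy_blocks a b k 0) p \<longleftrightarrow>
     (\<exists>m\<le>2 ^ k. p = replicate m a) \<or> suffix p (replicate (2 ^ k) a @ [b]) \<or>
     suffix p (replicate (2 ^ k) a @ [b, b]) \<or> suffix p (replicate (2 ^ k) a @ [b, b, b, b])"
  using copyable_snoc[of "doubling a k @ [[b], [b]]" "[b, b]" p]
    copyable_snoc[of "doubling a k @ [[b]]" "[b]" p] copyable_snoc[of "doubling a k" "[b]" p]
  by (simp add: copyable_doubling)

lemma copyable_greedy_blocks_Suc: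
  "copyable (greedy_blocks a b k (Suc n)) p \<longleftrightarrow> copyable (greedy_blocks a b k n) p \<or>
     suffix p (blocks a b k n @ replicate (Suc n) a @ [b, b]) \<or> suffix p (blocks a b k (Suc n))"
  using copyable_snoc[of "greedy_blocks a b k n @ [replicate (Suc n) a @ [b, b]]" "[b]" p]
    copyable_snoc[of "greedy_blocks a b k n" "replicate (Suc n) a @ [b, b]" p]
  by simp

lemma suffix_snoc_last: "suffix p (xs @ [x]) \<Longrightarrow> p \<noteq> [] \<Longrightarrow> last p = x"
  by auto

text \<open>Past the initial run every phrase ends in \<open>b\<close>, so a copy containing
  \<open>b\<close> cannot stop inside a run of \<open>a\<close>.\<close>

lemma copyable_greedy_blocks_last:
  assumes "copyable (greedy_blocks a b k n) p" "b \<in> set p"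
  shows "last p = b"
  using assms(1)
proof (induction n)
  case 0
  with assms(2) ab show ?case
    using suffix_snoc_last[of p "replicate (2 ^ k) a" b]
      suffix_snoc_last[of p "replicate (2 ^ k) a @ [b]" b]
      suffix_snoc_last[of p "replicate (2 ^ k) a @ [b, b, b]" b]
    unfolding copyable_greedy_blocks_0 by fastforce
next
  case (Suc n)
  with assms(2) show ?case
    using suffix_snoc_last[of p "blocks a b k n @ replicate (Suc n) a @ [b]" b]
      suffix_snoc_last[of p "blocks a b k n @ replicate (Suc n) a @ [b, b]" b]
    unfolding copyable_greedy_blocks_Suc by fastforce
qed

lemma prefix_replicate_iff: "prefix (replicate i a) (replicate m a @ b # xs) \<longleftrightarrow> i \<le> m"
proof (induction m arbitrary: i)
  case 0
  then show ?case using ab by (cases i) auto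
next
  case (Suc m)
  then show ?case by (cases i) auto
qed

text \<open>A phrase end preceded by \<open>bbb\<close> either follows \<open>bbbb\<close>, where a
  further \<open>b\<close> stands in front, or closes a later block, whose run of at most
  \<open>n\<close> letters is too short.\<close>

lemma not_copyable_greedy_blocks:
  assumes "n < i"
  shows "\<not> copyable (greedy_blocks a b k n) (replicate i a @ [b, b, b])"
  using assms
proof (induction n)
  case 0
  have "replicate i a @ [b, b, b] \<noteq> replicate m a" for m
    using ab by (metis in_set_conv_decomp in_set_replicate append_Cons)
  moreover have b_free: "\<not> suffix (xs @ [b]) (replicate (2 ^ k) a)" for xs
    using ab set_mono_suffix[of "xs @ [b]" "replicate (2 ^ k) a"] by auto
  have "\<not> suffix (replicate i a @ [b, b, b]) (replicate (2 ^ k) a @ [b])"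
    using b_free[of "replicate i a @ [b]"] same_suffix_suffix[of "replicate i a @ [b, b]" "[b]"] by simp
  moreover have "\<not> suffix (replicate i a @ [b, b, b]) (replicate (2 ^ k) a @ [b, b])"
    using b_free[of "replicate i a"] same_suffix_suffix[of "replicate i a @ [b]" "[b, b]"] by simp
  \<comment> \<open>Since \<open>0 < i\<close>, the left string ends in \<open>a\<close>.\<close>
  moreover have "\<not> suffix (replicate i a) (replicate (2 ^ k) a @ [b])"
    using suffix_snoc_last[of "replicate i a"] 0 ab by fastforce
  then have "\<not> suffix (replicate i a @ [b, b, b]) (replicate (2 ^ k) a @ [b, b, b, b])"
    using same_suffix_suffix[of "replicate i a" "[b, b, b]" "replicate (2 ^ k) a @ [b]"] by simp
  ultimately show ?case unfolding copyable_greedy_blocks_0 by blast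
next
  case (Suc n)
  obtain xs where "blocks a b k n = xs @ [b]" using blocks_ends[of a b k n] by blast
  with Suc show ?case
    using ab prefix_replicate_iff[of i "Suc n" "rev xs"]
    by (cases n; auto simp: copyable_greedy_blocks_Suc suffix_to_prefix replicate_app_Cons_same
        simp del: greedy_blocks.simps)
qed

text \<open>The phrase end after \<open>a^(2^k) bb\<close> in the opening block serves all these
  \<open>i\<close>.\<close>

lemma copyable_greedy_blocks:
  assumes "i \<le> 2 ^ k"
  shows "copyable (greedy_blocks a b k n) (replicate i a @ [b, b])"
proof (induction n)
  case 0
  have "suffix (replicate i a) (replicate (2 ^ k) a)"
    unfolding suffix_replicate_iff using assms by blast
  then have "suffix (replicate i a @ [b, b]) (replicate (2 ^ k) a @ [b, b])"
    by (simp only: same_suffix_suffix)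
  then show ?case unfolding copyable_greedy_blocks_0 by blast
next
  case (Suc n)
  then show ?case unfolding copyable_greedy_blocks_Suc by blast
qed

text \<open>A copy that continues past \<open>b\<close> into the remainder must end in
  \<open>b\<close> again, hence covers the whole next run. It then contains \<open>b a^m b\<close>,
  which is new.\<close>

lemma copyable_no_extension:
  assumes "copyable qs (x @ b # t)" "prefix t v"
    and v: "v = [] \<or> (\<exists>u. v = replicate m a @ b # u)"
    and last: "\<And>p. copyable qs p \<Longrightarrow> b \<in> set p \<Longrightarrow> last p = b"
    and new: "\<not> sublist (b # replicate m a @ [b]) (concat qs)"
  shows "t = []"
proof (rule ccontr)
  assume t: "t \<noteq> []"
  then obtain u where u: "v = replicate m a @ b # u" using assms(2) v by auto
  have "last t = b" using last[OF assms(1)] t by simp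
  then have "b \<in> set t" using t by (metis last_in_set)
  from assms(2) u consider "prefix t (replicate m a)"
    | s where "t = replicate m a @ s" "prefix s (b # u)"
    by (auto simp: prefix_append)
  then show False
  proof cases
    case 1
    then have "set t \<subseteq> {a}" using set_mono_prefix[of t "replicate m a"] by auto
    with \<open>b \<in> set t\<close> ab show False by auto
  next
    case 2
    with \<open>b \<in> set t\<close> ab have "s \<noteq> []" by auto
    with 2 obtain s' where "t = replicate m a @ b # s'" by (cases s) auto
    then have "x @ b # t = x @ (b # replicate m a @ [b]) @ s'" by simp
    then have "sublist (b # replicate m a @ [b]) (x @ b # t)" by (metis sublist_appendI)
    with copyable_imp_sublist[OF assms(1)] new show False
      by (metis sublist_order.order.trans)
  qed
qed

text \<open>A suffix starting with \<open>b\<close> cannot start inside the run of \<open>a\<close>.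
  This bounds the copies available within \<open>bbbb\<close>.\<close>

lemma suffix_replicate_append:
  assumes "suffix (b # t) (replicate m a @ y)"
  shows "length (b # t) \<le> length y"
proof (cases "suffix (b # t) y")
  case True
  then show ?thesis by (rule suffix_length_le)
next
  case False
  with assms obtain s where s: "b # t = s @ y" "suffix s (replicate m a)"
    by (auto simp: suffix_append)
  then have "set s \<subseteq> {a}" using set_mono_suffix[of s "replicate m a"] by auto
  with s(1) ab have "s = []" by (cases s) auto
  with s(1) show ?thesis by simp
qed

text \<open>The first \<open>b\<close> is a new symbol. After it, the longest copyable string
  starting with \<open>b\<close> has length 1, then 2, which forces \<open>b|b|bb\<close> whatever
  follows.\<close>

lemma greedy_prefix_greedy_blocks_0: "greedy_prefix (greedy_blocks a b k 0) v"
proof -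
  have not_rep: "b # t \<noteq> replicate m a" for t m
    using ab by (metis in_set_replicate list.set_intros(1))
  have 1: "greedy_prefix (doubling a k @ [[b]]) u" for u
    using ab by (simp add: greedy_prefix_snoc greedy_prefix_doubling greedy_phrase_def)
  have "greedy_phrase (doubling a k @ [[b]]) ([b] @ u) [b]" for u
  proof (rule greedy_phraseI)
    fix t assume "copyable (doubling a k @ [[b]]) ([b] @ t)"
    then show "t = []"
      using not_rep suffix_replicate_append[of t "2 ^ k" "[b]"]
      by (auto simp: copyable_snoc copyable_doubling)
  qed (simp_all add: copyable_snoc)
  with 1 have 2: "greedy_prefix ((doubling a k @ [[b]]) @ [[b]]) u" for u
    unfolding greedy_prefix_snoc[of "doubling a k @ [[b]]"] by simp
  have "greedy_phrase ((doubling a k @ [[b]]) @ [[b]]) ([b, b] @ v) [b, b]"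
  proof (rule greedy_phraseI)
    fix t assume "copyable ((doubling a k @ [[b]]) @ [[b]]) ([b, b] @ t)"
    then have "(\<exists>m. b # b # t = replicate m a) \<or> suffix (b # b # t) (replicate (2 ^ k) a @ [b]) \<or>
        suffix (b # b # t) (replicate (2 ^ k) a @ [b, b])"
      unfolding copyable_snoc copyable_doubling by auto
    then have "length (b # b # t) \<le> 2"
      using not_rep by (fastforce dest: suffix_replicate_append)
    then show "t = []" by simp
  next
    show "copyable ((doubling a k @ [[b]]) @ [[b]]) [b, b]"
      unfolding copyable_snoc by (simp add: suffix_def)
  qed simp
  with 2 have "greedy_prefix (((doubling a k @ [[b]]) @ [[b]]) @ [[b, b]]) v"
    unfolding greedy_prefix_snoc[of "(doubling a k @ [[b]]) @ [[b]]"] by simp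
  then show ?thesis by simp
qed

text \<open>The condition on \<open>v\<close> says that the text stops here or continues with the
  next run, whose length has not yet occurred between two \<open>b\<close>; this keeps both phrases
  of a block from reaching into the next block.\<close>

lemma greedy_prefix_greedy_blocks:
  assumes "n \<le> 2 ^ k" "v = [] \<or> (\<exists>u. v = replicate (Suc n) a @ b # u)"
  shows "greedy_prefix (greedy_blocks a b k n) v"
  using assms
proof (induction n arbitrary: v)
  case 0
  show ?case by (rule greedy_prefix_greedy_blocks_0)
next
  case (Suc n)
  let ?G = "greedy_blocks a b k n" and ?q = "replicate (Suc n) a @ [b, b]"
  have pre: "greedy_prefix ?G (?q @ b # v)"
    using Suc by simp
  have 1: "greedy_phrase ?G (?q @ b # v) ?q"
  proof (rule greedy_phraseI)
    show "hd (?q @ b # v) \<in> set (concat ?G)" by (simp add: set_blocks)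
    show "copyable ?G ?q" using Suc.prems by (intro copyable_greedy_blocks)
    fix t assume t: "prefix t (b # v)" "copyable ?G (?q @ t)"
    show "t = []"
    proof (rule ccontr)
      assume "t \<noteq> []"
      with t(1) obtain s where s: "t = b # s" "prefix s v" by (cases t) auto
      \<comment> \<open>The extension is first cut down to the single letter \<open>b\<close>; what
        is left is \<open>a^(n+1) bbb\<close>, which is not copyable.\<close>
      have "s = []"
      proof (rule copyable_no_extension)
        show "copyable ?G (?q @ b # s)" using t(2) s(1) by simp
        show "\<not> sublist (b # replicate (Suc (Suc n)) a @ [b]) (concat ?G)"
          unfolding concat_greedy_blocks by (rule not_sublist_blocks) simp
      qed (use s(2) Suc.prems(2) copyable_greedy_blocks_last in blast)+
      with t(2) s not_copyable_greedy_blocks[of n "Suc n" k] show False by simp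
    qed
  qed
  have 2: "greedy_phrase (?G @ [?q]) ([b] @ v) [b]"
  proof (rule greedy_phraseI)
    show "hd ([b] @ v) \<in> set (concat (?G @ [?q]))" by simp
    show "copyable (?G @ [?q]) [b]" by (simp add: copyable_snoc suffix_def)
    fix t assume t: "prefix t v" "copyable (?G @ [?q]) ([b] @ t)"
    show "t = []"
    \<comment> \<open>Now \<open>x\<close> is empty: the phrase is the lone \<open>b\<close> that
      closes the block.\<close>
    proof (rule copyable_no_extension)
      show "copyable (?G @ [?q]) ([] @ b # t)" using t(2) by simp
      show "prefix t v" by (rule t(1))
      show "v = [] \<or> (\<exists>u. v = replicate (Suc (Suc n)) a @ b # u)" by (rule Suc.prems(2))
      show "last p = b" if "copyable (?G @ [?q]) p" "b \<in> set p" for p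
        using copyable_greedy_blocks_last[of k "Suc n" p] that
        by (auto simp: copyable_snoc copyable_greedy_blocks_Suc simp del: greedy_blocks.simps)
      have "sublist (concat (?G @ [?q])) (blocks a b k (Suc n))"
        by (auto intro!: prefix_imp_sublist)
      then show "\<not> sublist (b # replicate (Suc (Suc n)) a @ [b]) (concat (?G @ [?q]))"
        using not_sublist_blocks[of "Suc n" "Suc (Suc n)" k] by (metis lessI sublist_order.order.trans)
    qed
  qed
  have "greedy_prefix ((?G @ [?q]) @ [[b]]) v"
    unfolding greedy_prefix_snoc using pre 1 2 by simp
  then show ?case by simp
qed

section \<open>Phrase counts and the limit\<close>

lemma z_e_blocks: "z_e (blocks a b k (2 ^ k)) = k + 4 + 2 * 2 ^ k"
  using z_e_eqI[OF greedy_prefix_imp_lz_end_greedy[OF greedy_prefix_greedy_blocks[of "2 ^ k" k "[]"]]]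
  by (simp add: length_greedy_blocks)

lemma z_end_blocks:
  "2 ^ k < z_end (blocks a b k (2 ^ k))" "z_end (blocks a b k (2 ^ k)) \<le> k + 5 + 2 ^ k"
proof -
  show "2 ^ k < z_end (blocks a b k (2 ^ k))"
    using z_end_attained[of "blocks a b k (2 ^ k)"] length_lz_end_like_ge by metis
  show "z_end (blocks a b k (2 ^ k)) \<le> k + 5 + 2 ^ k"
    unfolding z_end_def
    using lz_end_like_short_blocks(1)[OF order.refl, of k] length_short_blocks[of a b k "2 ^ k"]
    by (intro Least_le) blast
qed

end

theorem theorem2:
  fixes a b :: 'a
  assumes "a \<noteq> b"
  shows "\<exists>w :: nat \<Rightarrow> 'a list.
    (\<forall>k\<ge>1. w k \<noteq> [] \<and> set (w k) \<subseteq> {a, b}) \<and>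
    (\<lambda>k. real (z_e (w k)) / real (z_end (w k))) \<longlonglongrightarrow> 2"
proof (intro exI conjI)
  let ?w = "\<lambda>k. blocks a b k (2 ^ k)"
  show "\<forall>k\<ge>1. ?w k \<noteq> [] \<and> set (?w k) \<subseteq> {a, b}"
    by (metis set_blocks insert_not_empty list.set(1) order.refl)
  let ?num = "\<lambda>k. real k + 4 + 2 * 2 ^ k"
  \<comment> \<open>\<open>z_end\<close> lies between \<open>2 ^ k\<close> and
    \<open>2 ^ k + k + 5\<close>, and \<open>z_e\<close> is known exactly, so the ratio is squeezed
    between two explicit sequences with limit 2.\<close>
  have lower: "?num k / (real k + 5 + 2 ^ k) \<le> real (z_e (?w k)) / real (z_end (?w k))"
    and upper: "real (z_e (?w k)) / real (z_end (?w k)) \<le> ?num k / 2 ^ k" for k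
  proof -
    have z: "(2::real) ^ k < real (z_end (?w k))" "real (z_end (?w k)) \<le> real k + 5 + 2 ^ k"
      using z_end_blocks[OF assms, of k] by (metis of_nat_less_iff of_nat_numeral of_nat_power)
        (use z_end_blocks(2)[OF assms, of k] in \<open>simp flip: of_nat_le_iff[where ?'a = real]\<close>)
    moreover have "0 < (2::real) ^ k" by simp
    moreover have "real (z_e (?w k)) = ?num k" by (simp add: z_e_blocks[OF assms])
    ultimately show "?num k / (real k + 5 + 2 ^ k) \<le> real (z_e (?w k)) / real (z_end (?w k))"
      "real (z_e (?w k)) / real (z_end (?w k)) \<le> ?num k / 2 ^ k"
      by (auto intro!: divide_left_mono mult_pos_pos)
  qed
  show "(\<lambda>k. real (z_e (?w k)) / real (z_end (?w k))) \<longlonglongrightarrow> 2"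
  proof (rule tendsto_sandwich)
    show "(\<lambda>k. ?num k / (real k + 5 + 2 ^ k)) \<longlonglongrightarrow> 2" by real_asymp
    show "(\<lambda>k. ?num k / 2 ^ k) \<longlonglongrightarrow> 2" by real_asymp
  qed (use lower upper in \<open>simp_all\<close>)
qed

end
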